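(* For all $\varphi,\psi\in Sen(L_s)$, $$\varphi\wedge\psi\models_s\varphi|\psi \quad\text{and}\quad \varphi|\psi\models_s\varphi\vee\psi .$$ Moreover, these cannot be reversed in general: there exist $\varphi,\psi\in Sen(L_s)$ with $\varphi\vee\psi\not\models_s\varphi|\psi$, and there exist $\varphi,\psi\in Sen(L_s)$ with $\varphi|\psi\not\models_s\varphi\wedge\psi$.
   Context: Let $L$ be the propositional language with atomic sentences $p_0,p_1,\ldots$ and connectives $\neg,\wedge$ (with $\vee,\rightarrow,\leftrightarrow$ defined from them as usual); $Sen(L)$ is its set of sentences. $L_s$ is $L$ extended by a new primitive binary connective $|$; $Sen(L_s)$ is the set of sentences built from the atoms using $\neg,\wedge,|$. A truth assignment $M$ is a classical two-valued valuation of $Sen(L)$; $M\models\alpha$ means $\alpha$ is true under $M$. A choice function for $L$ is a map $f$ assigning to each set $\{\alpha,\beta\}$ with $\alpha,\beta\in Sen(L)$ (possibly $\alpha=\beta$) an element $f(\alpha,\beta)\in\{\alpha,\beta\}$; $\mathcal F$ is the set of all choice functions for $L$. Each $f$ induces $\overline f:Sen(L_s)\to Sen(L)$ by $\overline f(\alpha)=\alpha$ for $\alpha\in Sen(L)$, $\overline f(\varphi\wedge\psi)=\overline f(\varphi)\wedge\overline f(\psi)$, $\overline f(\neg\varphi)=\neg\overline f(\varphi)$, $\overline f(\varphi|\psi)=f(\overline f(\varphi),\overline f(\psi))$. Define $\langle M,f\rangle\models_s\varphi$ iff $M\models\overline f(\varphi)$. Then $\varphi\models_s\psi$ means: for every truth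 assignment $M$ and every $f\in\mathcal F$, $\langle M,f\rangle\models_s\varphi$ implies $\langle M,f\rangle\models_s\psi$. *)

theory Defs
  imports Main
begin

datatype sen = Atom nat | Neg sen | And sen sen

text \<open>
  The sentences of the language with the additional primitive connective; \<open>Sup\<^sub>s \<phi> \<psi>\<close>
  is the sentence written \<open>\<phi>|\<psi>\<close>.
\<close>

datatype sen_s = Atom\<^sub>s nat | Neg\<^sub>s sen_s | And\<^sub>s sen_s sen_s | Sup\<^sub>s sen_s sen_s

abbreviation Or\<^sub>s :: "sen_s \<Rightarrow> sen_s \<Rightarrow> sen_s" where
  "Or\<^sub>s \<phi> \<psi> \<equiv> Neg\<^sub>s (And\<^sub>s (Neg\<^sub>s \<phi>) (Neg\<^sub>s \<psi>))"

text \<open>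
  Since \<open>sen\<close> and \<open>sen_s\<close> are separate types, the inclusion of \<open>Sen(L)\<close> in \<open>Sen(L\<^sub>s)\<close> is a map.
\<close>

primrec embed :: "sen \<Rightarrow> sen_s" where
  "embed (Atom n) = Atom\<^sub>s n"
| "embed (Neg \<alpha>) = Neg\<^sub>s (embed \<alpha>)"
| "embed (And \<alpha> \<beta>) = And\<^sub>s (embed \<alpha>) (embed \<beta>)"

definition truth_assignment :: "(sen \<Rightarrow> bool) \<Rightarrow> bool" where
  "truth_assignment M \<longleftrightarrow>
     (\<forall>\<alpha>. M (Neg \<alpha>) \<longleftrightarrow> \<not> M \<alpha>) \<and> (\<forall>\<alpha> \<beta>. M (And \<alpha> \<beta>) \<longleftrightarrow> M \<alpha> \<and> M \<beta>)"

lemma truth_assignment_unique_extension: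
  "\<exists>!M. truth_assignment M \<and> (\<forall>n. M (Atom n) \<longleftrightarrow> v n)"
proof (rule ex_ex1I)
  define M where "M = rec_sen v (\<lambda>_ a. \<not> a) (\<lambda>_ _ a b. a \<and> b)"
  have "truth_assignment M \<and> (\<forall>n. M (Atom n) \<longleftrightarrow> v n)"
    by (simp add: M_def truth_assignment_def)
  then show "\<exists>M. truth_assignment M \<and> (\<forall>n. M (Atom n) \<longleftrightarrow> v n)" by blast
next
  fix M N
  assume M: "truth_assignment M \<and> (\<forall>n. M (Atom n) \<longleftrightarrow> v n)"
    and N: "truth_assignment N \<and> (\<forall>n. N (Atom n) \<longleftrightarrow> v n)"
  have "M \<alpha> \<longleftrightarrow> N \<alpha>" for \<alpha>
    using M N by (induction \<alpha>) (auto simp: truth_assignment_def)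
  then show "M = N" by blast
qed

text \<open>
  The argument of a choice function is the unordered pair \<open>{\<alpha>, \<beta>}\<close>, so the choice does not
  depend on the order of the two sentences. The values on other sets are irrelevant.
\<close>

definition choice_function :: "(sen set \<Rightarrow> sen) \<Rightarrow> bool" where
  "choice_function f \<longleftrightarrow> (\<forall>\<alpha> \<beta>. f {\<alpha>, \<beta>} \<in> {\<alpha>, \<beta>})"

primrec collapse :: "(sen set \<Rightarrow> sen) \<Rightarrow> sen_s \<Rightarrow> sen" where
  "collapse f (Atom\<^sub>s n) = Atom n"
| "collapse f (Neg\<^sub>s \<phi>) = Neg (collapse f \<phi>)"
| "collapse f (And\<^sub>s \<phi> \<psi>) = And (collapse f \<phi>) (collapse f \<psi>)"
| "collapse f (Sup\<^sub>s \<phi> \<psi>) = f {collapse f \<phi>, collapse f \<psi>}"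

lemma collapse_embed: "collapse f (embed \<alpha>) = \<alpha>"
  by (induction \<alpha>) simp_all

definition sat_s :: "(sen \<Rightarrow> bool) \<Rightarrow> (sen set \<Rightarrow> sen) \<Rightarrow> sen_s \<Rightarrow> bool" where
  "sat_s M f \<phi> \<longleftrightarrow> M (collapse f \<phi>)"

definition entails_s :: "sen_s \<Rightarrow> sen_s \<Rightarrow> bool" (infix "\<Turnstile>\<^sub>s" 50) where
  "\<phi> \<Turnstile>\<^sub>s \<psi> \<longleftrightarrow>
     (\<forall>M f. truth_assignment M \<longrightarrow> choice_function f \<longrightarrow> sat_s M f \<phi> \<longrightarrow> sat_s M f \<psi>)"

end

theory Submission
  imports Defs
begin

text \<open>Fix a truth assignment and a choice function. The superposition of two sentences
  collapses to the collapse of one of them, so its truth value is that of one component: it is true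
  when both are, and it can be true only if at least one is. Splitting on the chosen component
  (\<open>choice_function_cases\<close>) gives \<open>And_entails_Sup\<close> and
  \<open>Sup_entails_Or\<close>. Neither converse holds, because the choice is independent of truth:
  for one true and one false atom, a choice function may select either
  (\<open>not_Or_entails_Sup\<close>, \<open>not_Sup_entails_And\<close>).\<close>

lemma truth_assignment_simps:
  assumes "truth_assignment M"
  shows "M (Neg \<alpha>) \<longleftrightarrow> \<not> M \<alpha>" and "M (And \<alpha> \<beta>) \<longleftrightarrow> M \<alpha> \<and> M \<beta>"
  using assms by (simp_all add: truth_assignment_def)

lemma choice_function_cases:
  assumes "choice_function f"
  obtains "f {\<alpha>, \<beta>} = \<alpha>" | "f {\<alpha>, \<beta>} = \<beta>"
  using assms by (auto simp: choice_function_def)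

lemma And_entails_Sup: "And\<^sub>s \<phi> \<psi> \<Turnstile>\<^sub>s Sup\<^sub>s \<phi> \<psi>"
  unfolding entails_s_def sat_s_def
proof (intro allI impI)
  fix M f
  assume M: "truth_assignment M" and f: "choice_function f"
    and "M (collapse f (And\<^sub>s \<phi> \<psi>))"
  then show "M (collapse f (Sup\<^sub>s \<phi> \<psi>))"
    by (cases rule: choice_function_cases[OF f, of "collapse f \<phi>" "collapse f \<psi>"])
      (simp_all add: truth_assignment_simps[OF M])
qed

lemma Sup_entails_Or: "Sup\<^sub>s \<phi> \<psi> \<Turnstile>\<^sub>s Or\<^sub>s \<phi> \<psi>"
  unfolding entails_s_def sat_s_def
proof (intro allI impI)
  fix M f
  assume M: "truth_assignment M" and f: "choice_function f"
    and "M (collapse f (Sup\<^sub>s \<phi> \<psi>))"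
  then show "M (collapse f (Or\<^sub>s \<phi> \<psi>))"
    by (cases rule: choice_function_cases[OF f, of "collapse f \<phi>" "collapse f \<psi>"])
      (simp_all add: truth_assignment_simps[OF M])
qed

text \<open>Supplies the choice functions of both countermodels: there \<gamma> is the atom that the
  superposition should collapse to.\<close>

lemma ex_choice_function_preferring:
  "\<exists>f. choice_function f \<and> (\<forall>\<beta>. f {\<gamma>, \<beta>} = \<gamma>)"
proof -
  \<comment> \<open>The fallback handles pairs without \<gamma>; as a pair is nonempty,
    \<open>SOME\<close> returns one of its members.\<close>
  define f where "f S = (if \<gamma> \<in> S then \<gamma> else SOME \<alpha>. \<alpha> \<in> S)" for S
  have "f {\<alpha>, \<beta>} \<in> {\<alpha>, \<beta>}" for \<alpha> \<beta>
    unfolding f_def by (metis insertI1 someI_ex)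
  then show ?thesis
    unfolding choice_function_def by (intro exI[of _ f]) (simp add: f_def)
qed

lemma ex_truth_assignment_separating_atoms:
  "\<exists>M. truth_assignment M \<and> M (Atom 0) \<and> \<not> M (Atom 1)"
  using ex1_implies_ex[OF truth_assignment_unique_extension[of "\<lambda>n. n = 0"]] by auto

text \<open>The choice falls on the false atom, while the true one still verifies the
  disjunction.\<close>

lemma not_Or_entails_Sup: "\<not> (Or\<^sub>s (Atom\<^sub>s 0) (Atom\<^sub>s 1) \<Turnstile>\<^sub>s Sup\<^sub>s (Atom\<^sub>s 0) (Atom\<^sub>s 1))"
proof -
  obtain M where M: "truth_assignment M" "M (Atom 0)" "\<not> M (Atom 1)"
    using ex_truth_assignment_separating_atoms by blast
  obtain f where f: "choice_function f" "f {Atom 1, Atom 0} = Atom 1"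
    using ex_choice_function_preferring by blast
  \<comment> \<open>The preferred sentence comes first in the pair that was obtained; pairs are
    unordered, so it may be swapped to match the collapse.\<close>
  have "f {Atom 0, Atom 1} = Atom 1"
    using f(2) by (simp only: insert_commute)
  then have "sat_s M f (Or\<^sub>s (Atom\<^sub>s 0) (Atom\<^sub>s 1))" "\<not> sat_s M f (Sup\<^sub>s (Atom\<^sub>s 0) (Atom\<^sub>s 1))"
    using M by (simp_all add: sat_s_def truth_assignment_simps[OF M(1)])
  then show ?thesis
    using M(1) f(1) unfolding entails_s_def by blast
qed

text \<open>Here the choice falls on the true atom, while the false one refutes the
  conjunction.\<close>

lemma not_Sup_entails_And: "\<not> (Sup\<^sub>s (Atom\<^sub>s 0) (Atom\<^sub>s 1) \<Turnstile>\<^sub>s And\<^sub>s (Atom\<^sub>s 0) (Atom\<^sub>s 1))"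
proof -
  obtain M where M: "truth_assignment M" "M (Atom 0)" "\<not> M (Atom 1)"
    using ex_truth_assignment_separating_atoms by blast
  obtain f where f: "choice_function f" "f {Atom 0, Atom 1} = Atom 0"
    using ex_choice_function_preferring by blast
  have "sat_s M f (Sup\<^sub>s (Atom\<^sub>s 0) (Atom\<^sub>s 1))" "\<not> sat_s M f (And\<^sub>s (Atom\<^sub>s 0) (Atom\<^sub>s 1))"
    using M f(2) by (simp_all add: sat_s_def truth_assignment_simps[OF M(1)])
  then show ?thesis
    using M(1) f(1) unfolding entails_s_def by blast
qed

theorem theorem2p8:
  shows "(\<forall>\<phi> \<psi>. And\<^sub>s \<phi> \<psi> \<Turnstile>\<^sub>s Sup\<^sub>s \<phi> \<psi> \<and> Sup\<^sub>s \<phi> \<psi> \<Turnstile>\<^sub>s Or\<^sub>s \<phi> \<psi>) \<and>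
    (\<exists>\<phi> \<psi>. \<not> (Or\<^sub>s \<phi> \<psi> \<Turnstile>\<^sub>s Sup\<^sub>s \<phi> \<psi>)) \<and>
    (\<exists>\<phi> \<psi>. \<not> (Sup\<^sub>s \<phi> \<psi> \<Turnstile>\<^sub>s And\<^sub>s \<phi> \<psi>))"
  using And_entails_Sup Sup_entails_Or not_Or_entails_Sup not_Sup_entails_And by blast

end
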